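(* For a Puiseux monoid $M$, the following statements are equivalent. (1) $M$ is root-closed. (2) $\mathrm{gp}(M) = M \cup -M$. (3) $M$ is a Prüfer monoid.
   Context: A Puiseux monoid is an additive submonoid of $\mathbb{Q}_{\ge 0}$. For a Puiseux monoid $M$, the difference group is $\mathrm{gp}(M) = \{x-y \mid x,y \in M\} \subseteq \mathbb{Q}$, $-M = \{-x \mid x \in M\}$, and the root closure is $\widetilde{M} := \{x \in \mathrm{gp}(M) \mid kx \in M \text{ for some } k \in \mathbb{N}\}$, where $\mathbb{N} = \{1,2,3,\dots\}$. $M$ is root-closed if $\widetilde{M} = M$. $M$ is a Prüfer monoid if $M$ is the union of an ascending sequence of cyclic submonoids (submonoids generated by a single element). *)

theory Defs
  imports Complex_Main
begin

definition add_submonoid :: "'a::comm_monoid_add set \<Rightarrow> bool" where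
  "add_submonoid M \<longleftrightarrow> 0 \<in> M \<and> (\<forall>x\<in>M. \<forall>y\<in>M. x + y \<in> M)"

definition puiseux_monoid :: "rat set \<Rightarrow> bool" where
  "puiseux_monoid M \<longleftrightarrow> add_submonoid M \<and> (\<forall>x\<in>M. 0 \<le> x)"

definition difference_group :: "rat set \<Rightarrow> rat set" where
  "difference_group M = {x - y |x y. x \<in> M \<and> y \<in> M}"

definition root_closure :: "rat set \<Rightarrow> rat set" where
  "root_closure M = {x \<in> difference_group M. \<exists>k::nat. k \<ge> 1 \<and> of_nat k * x \<in> M}"

definition root_closed :: "rat set \<Rightarrow> bool" where
  "root_closed M \<longleftrightarrow> root_closure M = M"

definition cyclic_submonoid :: "'a::comm_monoid_add set \<Rightarrow> bool" where
  "cyclic_submonoid C \<longleftrightarrow> (\<exists>a. C = add_submonoid hull {a})"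

(* Ascending is meant weakly: the sequence may become stationary, so that a
   cyclic monoid, including the trivial one {0}, is a Pruefer monoid. *)
definition pruefer_monoid :: "rat set \<Rightarrow> bool" where
  "pruefer_monoid M \<longleftrightarrow>
     (\<exists>C :: nat \<Rightarrow> rat set. incseq C \<and> (\<forall>n. cyclic_submonoid (C n)) \<and> M = (\<Union>n. C n))"

end

theory Submission
  imports Defs "HOL-Library.Countable_Set"
begin

text \<open>
  If \<open>M\<close> satisfies (2), then \<open>b - a \<in> M\<close> whenever \<open>a \<le> b\<close> are in \<open>M\<close>, so the subtractive
  Euclidean algorithm runs inside \<open>M\<close> and any two elements of \<open>M\<close> are multiples of a third one.
  Applied along an enumeration of the countable set \<open>M\<close>, this produces the ascending chain of
  cyclic submonoids. Conversely, two elements of a Pruefer monoid are multiples \<open>p a\<close> and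
  \<open>q a\<close> of one element, and their difference is \<open>\<plusminus>\<bar>p - q\<bar> a\<close>. For (1) implies (2), any
  positive \<open>x = y - z\<close> in the difference group is commensurable with \<open>y \<in> M\<close>.
\<close>

lemma add_submonoid_zero: "add_submonoid M \<Longrightarrow> 0 \<in> M"
  by (simp add: add_submonoid_def)

lemma add_submonoid_add: "add_submonoid M \<Longrightarrow> x \<in> M \<Longrightarrow> y \<in> M \<Longrightarrow> x + y \<in> M"
  by (simp add: add_submonoid_def)

lemma add_submonoid_of_nat_mult:
  fixes a :: "'a::semiring_1"
  assumes "add_submonoid M" "a \<in> M"
  shows "of_nat n * a \<in> M"
  by (induction n)
    (use assms in \<open>auto simp: distrib_right intro: add_submonoid_zero add_submonoid_add\<close>)

text \<open>Turns membership in a cyclic submonoid into a natural coefficient of its generator, the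
  form in which all later computations are done.\<close>

lemma add_submonoid_hull_singleton:
  fixes a :: "'a::semiring_1"
  shows "add_submonoid hull {a} = range (\<lambda>n. of_nat n * a)"
proof (rule hull_unique)
  show "{a} \<subseteq> range (\<lambda>n. of_nat n * a)"
    by (auto intro: range_eqI[of _ _ 1])
  show "add_submonoid (range (\<lambda>n. of_nat n * a))"
    unfolding add_submonoid_def
  proof (safe)
    show "0 \<in> range (\<lambda>n. of_nat n * a)"
      by (rule range_eqI[of _ _ 0]) simp
    show "of_nat m * a + of_nat n * a \<in> range (\<lambda>n. of_nat n * a)" for m n
      by (rule range_eqI[of _ _ "m + n"]) (simp add: distrib_right)
  qed
qed (auto intro: add_submonoid_of_nat_mult)

text \<open>Over the common denominator \<open>b * f\<close> the two fractions have positive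
  numerators \<open>a * f\<close> and \<open>e * b\<close>, so \<open>d\<close> is the reciprocal of
  that denominator.\<close>

lemma pos_rat_commensurable:
  fixes x y :: rat
  assumes "0 < x" "0 < y"
  obtains p q :: nat and d where "0 < p" "0 < q" "x = of_nat p * d" "y = of_nat q * d" "0 < d"
proof -
  obtain a b where ab: "x = Fract a b" "b > 0" by (cases x) auto
  obtain e f where ef: "y = Fract e f" "f > 0" by (cases y) auto
  have pos: "a > 0" "e > 0"
    using assms ab ef by (simp_all add: zero_less_Fract_iff)
  show thesis
  proof
    show "0 < nat (a * f)" "0 < nat (e * b)" "0 < (1 / of_int (b * f) :: rat)"
      using ab ef pos by simp_all
    show "x = of_nat (nat (a * f)) * (1 / of_int (b * f))"
      "y = of_nat (nat (e * b)) * (1 / of_int (b * f))"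
      using ab ef pos by (simp_all add: Fract_of_int_quotient of_nat_nat)
  qed
qed

text \<open>Euclid's algorithm on the coefficients, by induction on \<open>p + q\<close>. The unit
  \<open>d\<close> may lie outside \<open>M\<close>; being positive, it carries the order of
  coefficients over to the elements, as \<open>sub\<close> requires.\<close>

lemma common_divisor_if_subtractive:
  fixes M :: "rat set"
  assumes "0 < d" "of_nat p * d \<in> M" "of_nat q * d \<in> M"
    and sub: "\<And>a b. a \<in> M \<Longrightarrow> b \<in> M \<Longrightarrow> a \<le> b \<Longrightarrow> b - a \<in> M"
  shows "\<exists>c\<in>M. \<exists>m n::nat. of_nat p * d = of_nat m * c \<and> of_nat q * d = of_nat n * c"
  using assms(2,3)
proof (induction "p + q" arbitrary: p q rule: less_induct)
  case less
  consider "p = 0" | "q = 0" | "0 < p" "p \<le> q" | "0 < q" "q \<le> p" by linarith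
  then show ?case
  proof cases
    case 1
    then show ?thesis
      by (intro bexI[OF _ less.prems(2)] exI[of _ 0] exI[of _ 1]) simp
  next
    case 2
    then show ?thesis
      by (intro bexI[OF _ less.prems(1)] exI[of _ 1] exI[of _ 0]) simp
  next
    case 3
    have "of_nat (q - p) * d \<in> M"
      using sub[OF less.prems] 3 \<open>0 < d\<close> by (simp add: of_nat_diff left_diff_distrib)
    from less.hyps[OF _ less.prems(1) this] 3 obtain c m n where "c \<in> M"
      "of_nat p * d = of_nat m * c" "of_nat (q - p) * d = of_nat n * c" by auto
    \<comment> \<open>Adding back the subtracted \<open>p * d\<close>, which is
      \<open>m * c\<close>, adds the coefficients.\<close>
    moreover from this 3 have "of_nat q * d = of_nat (m + n) * c"
      by (simp add: of_nat_diff algebra_simps)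
    ultimately show ?thesis by blast
  next
    case 4
    have "of_nat (p - q) * d \<in> M"
      using sub[OF less.prems(2,1)] 4 \<open>0 < d\<close> by (simp add: of_nat_diff left_diff_distrib)
    from less.hyps[OF _ this less.prems(2)] 4 obtain c m n where "c \<in> M"
      "of_nat (p - q) * d = of_nat m * c" "of_nat q * d = of_nat n * c" by auto
    moreover from this 4 have "of_nat p * d = of_nat (m + n) * c"
      by (simp add: of_nat_diff algebra_simps)
    ultimately show ?thesis by blast
  qed
qed

context
  fixes M :: "rat set"
  assumes M: "puiseux_monoid M"
begin

lemma submonoid: "add_submonoid M"
  using M by (simp add: puiseux_monoid_def)

lemma nonneg: "x \<in> M \<Longrightarrow> 0 \<le> x"
  using M by (simp add: puiseux_monoid_def)

lemma subset_difference_group: "M \<union> uminus ` M \<subseteq> difference_group M"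
proof -
  have "x \<in> difference_group M" "- x \<in> difference_group M" if "x \<in> M" for x
    using that add_submonoid_zero[OF submonoid] diff_0_right[of x] diff_0[of x]
    unfolding difference_group_def by - (blast intro: sym)+
  then show ?thesis by blast
qed

lemma subset_root_closure: "M \<subseteq> root_closure M"
  using subset_difference_group unfolding root_closure_def by (auto intro!: exI[of _ 1])

lemma difference_group_eq_if_root_closed:
  assumes "root_closed M"
  shows "difference_group M = M \<union> uminus ` M"
proof (rule antisym[OF _ subset_difference_group])
  have pos: "x \<in> M" if x: "x \<in> difference_group M" "0 < x" for x
  proof -
    obtain y z where yz: "x = y - z" "y \<in> M" "z \<in> M"
      using x by (auto simp: difference_group_def)
    have "0 < y" using yz x nonneg[of z] by linarith
    with x(2) obtain p q d where pq: "0 < p" "0 < q" "x = of_nat p * d" "y = of_nat q * d"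
      by (rule pos_rat_commensurable)
    \<comment> \<open>Both sides equal \<open>p * q * d\<close>; hence \<open>q\<close> is the
      exponent that puts \<open>x\<close> into the root closure.\<close>
    have "of_nat q * x = of_nat p * y" using pq by simp
    then have "of_nat q * x \<in> M"
      using add_submonoid_of_nat_mult[OF submonoid yz(2)] by metis
    then have "x \<in> root_closure M"
      using x(1) pq(2) unfolding root_closure_def by (auto intro!: exI[of _ q])
    then show ?thesis using assms by (simp add: root_closed_def)
  qed
  show "difference_group M \<subseteq> M \<union> uminus ` M"
  proof
    fix x assume x: "x \<in> difference_group M"
    then have "- x \<in> difference_group M"
      unfolding difference_group_def by force
    with x pos have "0 < x \<Longrightarrow> x \<in> M" "x < 0 \<Longrightarrow> - x \<in> M" by simp_all
    moreover have "0 \<in> M" by (rule add_submonoid_zero[OF submonoid])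
    ultimately show "x \<in> M \<union> uminus ` M"
      by (cases x "0::rat" rule: linorder_cases) (auto intro: image_eqI[of x uminus "- x"])
  qed
qed

lemma mem_if_difference_group_eq:
  assumes "difference_group M = M \<union> uminus ` M" "x \<in> difference_group M" "0 \<le> x"
  shows "x \<in> M"
proof (rule ccontr)
  assume "x \<notin> M"
  with assms have "- x \<in> M" by auto
  with \<open>0 \<le> x\<close> nonneg have "x = 0" by force
  with \<open>x \<notin> M\<close> add_submonoid_zero[OF submonoid] show False by simp
qed

lemma root_closed_if_difference_group_eq:
  assumes "difference_group M = M \<union> uminus ` M"
  shows "root_closed M"
  unfolding root_closed_def
proof (rule antisym[OF _ subset_root_closure], rule subsetI)
  fix x assume "x \<in> root_closure M"
  then obtain k :: nat where x: "x \<in> difference_group M" "k \<ge> 1" "of_nat k * x \<in> M"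
    by (auto simp: root_closure_def)
  then have "0 \<le> x" using nonneg[OF x(3)] by (simp add: zero_le_mult_iff)
  with assms x(1) show "x \<in> M" by (rule mem_if_difference_group_eq)
qed

lemma pruefer_if_difference_group_eq:
  assumes eq: "difference_group M = M \<union> uminus ` M"
  shows "pruefer_monoid M"
proof -
  have sub: "b - a \<in> M" if "a \<in> M" "b \<in> M" "a \<le> b" for a b
    using that by (intro mem_if_difference_group_eq[OF eq]) (auto simp: difference_group_def)
  define cyc :: "rat \<Rightarrow> rat set" where "cyc c = range (\<lambda>n. of_nat n * c)" for c
  have cyc_hull: "cyc c = add_submonoid hull {c}" for c
    by (simp add: cyc_def add_submonoid_hull_singleton)
  have self: "c \<in> cyc c" for c
    by (simp add: cyc_hull hull_inc)
  have zero: "0 \<in> cyc c" for c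
    unfolding cyc_def by (rule range_eqI[of _ _ 0]) simp
  have common: "\<exists>c\<in>M. a \<in> cyc c \<and> b \<in> cyc c" if ab: "a \<in> M" "b \<in> M" for a b
  proof -
    consider "a = 0" | "b = 0" | "0 < a" "0 < b"
      using nonneg[OF ab(1)] nonneg[OF ab(2)] by linarith
    then show ?thesis
    proof cases
      case 3
      then obtain p q d where "a = of_nat p * d" "b = of_nat q * d" "0 < d"
        by (rule pos_rat_commensurable)
      with common_divisor_if_subtractive[OF _ _ _ sub, of d p q] ab show ?thesis
        unfolding cyc_def by auto
    qed (use ab self zero in blast)+
  qed
  have ne: "M \<noteq> {}" using add_submonoid_zero[OF submonoid] by blast
  define e where "e = from_nat_into M"
  \<comment> \<open>The enumeration may repeat values, so the finite case \<open>M = {0}\<close> is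
    covered too.\<close>
  have e: "range e = M"
    unfolding e_def by (rule range_from_nat_into[OF ne]) simp
  \<comment> \<open>The next generator is a common divisor in \<open>M\<close> of \<open>c n\<close>
    and \<open>e (Suc n)\<close>: the first makes the chain ascend, the second makes it exhaust
    \<open>M\<close>.\<close>
  have "\<exists>c. \<forall>n. (c n \<in> M \<and> e n \<in> cyc (c n)) \<and> c n \<in> cyc (c (Suc n))"
  proof (rule dependent_nat_choice)
    show "\<exists>x. x \<in> M \<and> e 0 \<in> cyc x" using e self by blast
    show "\<exists>y. (y \<in> M \<and> e (Suc n) \<in> cyc y) \<and> x \<in> cyc y" if "x \<in> M \<and> e n \<in> cyc x" for x n
      using common[of x "e (Suc n)"] that e by blast
  qed
  then obtain c where c: "\<And>n. c n \<in> M" "\<And>n. e n \<in> cyc (c n)" "\<And>n. c n \<in> cyc (c (Suc n))"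
    by blast
  have "cyc (c n) \<subseteq> cyc (c (Suc n))" for n
    using c(3)[of n] by (force simp: cyc_def simp flip: of_nat_mult mult.assoc)
  then have "incseq (\<lambda>n. cyc (c n))" by (rule incseq_SucI)
  moreover have "cyclic_submonoid (cyc (c n))" for n
    unfolding cyclic_submonoid_def cyc_hull by blast
  moreover have "cyc (c n) \<subseteq> M" for n
    using add_submonoid_of_nat_mult[OF submonoid c(1)] by (auto simp: cyc_def)
  then have "M = (\<Union>n. cyc (c n))" using c(2) e by blast
  ultimately show ?thesis unfolding pruefer_monoid_def by blast
qed

lemma difference_group_eq_if_pruefer:
  assumes "pruefer_monoid M"
  shows "difference_group M = M \<union> uminus ` M"
proof (rule antisym[OF _ subset_difference_group], rule subsetI)
  obtain C where C: "incseq C" "\<And>n. cyclic_submonoid (C n)" "M = (\<Union>n. C n)"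
    using assms by (auto simp: pruefer_monoid_def)
  fix x assume "x \<in> difference_group M"
  then obtain y z i j where yz: "x = y - z" "y \<in> C i" "z \<in> C j"
    using C(3) by (auto simp: difference_group_def)
  \<comment> \<open>By monotonicity of the chain, \<open>y\<close> and \<open>z\<close> both lie in
    this member and so share a generator.\<close>
  define n where "n = max i j"
  have mem: "y \<in> C n" "z \<in> C n"
    using yz incseqD[OF C(1), of i n] incseqD[OF C(1), of j n] by (auto simp: n_def)
  obtain a where a: "C n = range (\<lambda>k. of_nat k * a)"
    using C(2)[of n] by (auto simp: cyclic_submonoid_def add_submonoid_hull_singleton)
  obtain p q where pq: "y = of_nat p * a" "z = of_nat q * a"
    using mem a by auto
  have multiple: "of_nat k * a \<in> M" for k using a C(3) by blast
  show "x \<in> M \<union> uminus ` M"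
  \<comment> \<open>Subtraction on \<open>nat\<close> truncates, so the larger coefficient decides
    whether \<open>x\<close> falls into \<open>M\<close> or into its negative.\<close>
  proof (cases "q \<le> p")
    case True
    then have "x = of_nat (p - q) * a" by (simp add: yz pq of_nat_diff left_diff_distrib)
    with multiple show ?thesis by blast
  next
    case False
    then have "x = - (of_nat (q - p) * a)" by (simp add: yz pq of_nat_diff left_diff_distrib)
    with multiple show ?thesis by blast
  qed
qed

end

theorem corollary3p7:
  fixes M :: "rat set"
  assumes "puiseux_monoid M"
  shows "(root_closed M \<longleftrightarrow> difference_group M = M \<union> uminus ` M)
       \<and> (difference_group M = M \<union> uminus ` M \<longleftrightarrow> pruefer_monoid M)"
  using difference_group_eq_if_root_closed[OF assms] root_closed_if_difference_group_eq[OF assms]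
    pruefer_if_difference_group_eq[OF assms] difference_group_eq_if_pruefer[OF assms]
  by blast

end
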